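(* Let $f:\mathbb{R}\to\mathbb{R}$ be convex and $L$-smooth with $L>0$, and let $S=\operatorname{Argmin} f\neq\varnothing$. Let $x_0\in\mathbb{R}$ and let $x^*=P_S(x_0)$ be the point of $S$ closest to $x_0$. Let $(x_k)_{k\in\mathbb{N}}$ (together with $(y_k)_{k\in\mathbb{N}}$) be generated by Algorithm 1 (described in the context) from $x_0$ with input parameter sequence $\widetilde t_k=\frac{k+2}{2}$ for all $k\in\mathbb{N}$. For $p\ge1$ let $r_p$ denote the $p$-th iteration such that $f'(y_{r_p})(x_{r_p+1}-x_{r_p})>0$. Then for all $p\ge 2$ (for which these restart iterations occur) and all $k\in\{r_p+2,\ldots,r_{p+1}+1\}$ we have $$f(x_k)-f(x^* )\le\left(\frac{2^{p+1}}{(k-r_p)(r_p-r_{p-1}+2)\cdots(r_2-r_1+2)(r_1+2)}\right)^2\frac{L}{2}(x_0-x^* )^2\le\frac{2L(x_0-x^* )^2}{(k+1)^2}.$$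
   Context: $\mathbb{N}=\{0,1,2,\dots\}$. $L$-smooth means $f$ is differentiable and $|f'(x)-f'(y)|\le L|x-y|$ for all $x,y\in\mathbb{R}$. Set $T(y)=y-\tfrac1L f'(y)$. The denominator in the claim is $(k-r_p)\,\bigl(\prod_{i=2}^{p}(r_i-r_{i-1}+2)\bigr)(r_1+2)$. Algorithm 1 (accelerated gradient descent with restarts). Input: $x_0\in\mathbb{R}$ and a real sequence $(\widetilde t_k)_{k\in\mathbb{N}}$ (here $\widetilde t_k=\frac{k+2}{2}$). Initialization: $y_0=x_0$ and $t_k:=\widetilde t_k$ for all $k\in\mathbb{N}$. For $k=0,1,2,\dots$: set $x_{k+1}:=T(y_k)$. If $f'(y_k)(x_{k+1}-x_k)\le 0$, set $y_{k+1}:=x_{k+1}+\frac{t_k-1}{t_{k+1}}(x_{k+1}-x_k)$. Otherwise (the restart condition $f'(y_k)(x_{k+1}-x_k)>0$ holds at iteration $k$) restart: set $y_{k+1}:=x_{k+1}$ and redefine $t_{k+1+m}:=\widetilde t_m$ for all $m\in\mathbb{N}$. Stopping convention: if $f'(x_k)=0$ for some $k$, then $x_k$ is a minimizer and the algorithm is stopped. Thus, if iteration $r_{p+1}$ is carried out, $f'(x_j)\neq0$ for all $0\le j\le r_{p+1}$. *)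

theory Defs
  imports "HOL-Analysis.Analysis"
begin

definition L_smooth :: "real \<Rightarrow> (real \<Rightarrow> real) \<Rightarrow> bool" where
  "L_smooth L f \<longleftrightarrow>
     (\<forall>x. f differentiable (at x)) \<and> (\<forall>x y. \<bar>deriv f x - deriv f y\<bar> \<le> L * \<bar>x - y\<bar>)"

definition argmin_set :: "(real \<Rightarrow> real) \<Rightarrow> real set" where
  "argmin_set f = {x. is_arg_min f (\<lambda>_. True) x}"

definition grad_step :: "(real \<Rightarrow> real) \<Rightarrow> real \<Rightarrow> real \<Rightarrow> real" where
  "grad_step f L y = y - (1 / L) * deriv f y"

text \<open>The algorithm stops as soon as it meets a critical point \<open>x k\<close>; hence iteration \<open>k\<close>,
  the one producing \<open>x (Suc k)\<close>, is carried out iff none of \<open>x 0, \<dots>, x k\<close> is critical.\<close>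

definition carried_out :: "(real \<Rightarrow> real) \<Rightarrow> (nat \<Rightarrow> real) \<Rightarrow> nat \<Rightarrow> bool" where
  "carried_out f x k \<longleftrightarrow> (\<forall>j\<le>k. deriv f (x j) \<noteq> 0)"

definition restart_at :: "(real \<Rightarrow> real) \<Rightarrow> (nat \<Rightarrow> real) \<Rightarrow> (nat \<Rightarrow> real) \<Rightarrow> nat \<Rightarrow> bool" where
  "restart_at f x y k \<longleftrightarrow> carried_out f x k \<and> deriv f (y k) * (x (Suc k) - x k) > 0"

text \<open>Here \<open>tt\<close> is the input parameter sequence and \<open>t k\<close> is the whole parameter sequence
  as it stands when iteration \<open>k\<close> begins, so \<open>t k i\<close> is the current value of its \<open>i\<close>-th term.
  The values of \<open>x\<close> and \<open>y\<close> after the algorithm has stopped are left unconstrained.\<close>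

definition generated_by_restarted_agd ::
  "(real \<Rightarrow> real) \<Rightarrow> real \<Rightarrow> (nat \<Rightarrow> real) \<Rightarrow> real \<Rightarrow> (nat \<Rightarrow> real) \<Rightarrow> (nat \<Rightarrow> real) \<Rightarrow> bool" where
  "generated_by_restarted_agd f L tt x0 x y \<longleftrightarrow>
     x 0 = x0 \<and> y 0 = x0 \<and>
     (\<exists>t :: nat \<Rightarrow> nat \<Rightarrow> real.
        t 0 = tt \<and>
        (\<forall>k. carried_out f x k \<longrightarrow>
           x (Suc k) = grad_step f L (y k) \<and>
           (if deriv f (y k) * (x (Suc k) - x k) \<le> 0
            then y (Suc k) = x (Suc k) + (t k k - 1) / t k (Suc k) * (x (Suc k) - x k) \<and>
                 t (Suc k) = t k
            else y (Suc k) = x (Suc k) \<and>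
                 t (Suc k) = (\<lambda>i. if Suc k \<le> i then tt (i - Suc k) else t k i))))"

definition is_nth_restart ::
  "(real \<Rightarrow> real) \<Rightarrow> (nat \<Rightarrow> real) \<Rightarrow> (nat \<Rightarrow> real) \<Rightarrow> nat \<Rightarrow> nat \<Rightarrow> bool" where
  "is_nth_restart f x y q k \<longleftrightarrow> restart_at f x y k \<and> card {j. j \<le> k \<and> restart_at f x y j} = q"

end

theory Submission
  imports Defs
begin

text \<open>The points of \<open>S\<close> are the zeros of the nondecreasing function \<open>deriv f\<close>.
  Within one phase (from one restart to the next) the iterates move monotonically towards \<open>S\<close>
  and only the very last step can overshoot. Before that, the gradients at the
  extrapolated points decrease in absolute value, which forces the increment
  \<open>x (j + 1) - x j\<close> divided by \<open>j + 3\<close> to decrease. The last increment before the overshoot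
  is therefore small compared with the total distance travelled, and the overshoot is at most
  \<open>2 / (m + 3)\<close> times the initial distance, \<open>m\<close> being the local index of the restart. This is
  slightly better than the factor \<open>2 / (m + 2)\<close> given by the usual Lyapunov function, which is
  only used for the function values of the last phase.\<close>

section \<open>Convex functions with Lipschitz derivative\<close>

lemma convex_above_tangent_deriv:
  fixes f :: "real \<Rightarrow> real"
  assumes "convex_on UNIV f" "f differentiable (at y)"
  shows "f z \<ge> f y + deriv f y * (z - y)"
proof -
  have "(f has_real_derivative deriv f y) (at y)"
    using assms(2) by (simp add: DERIV_deriv_iff_real_differentiable)
  then have "f z - f y \<ge> deriv f y * (z - y)"
    using convex_on_imp_above_tangent[OF assms(1), of y z "deriv f y"] by simp
  then show ?thesis by simp
qed

lemma convex_deriv_mono: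
  fixes f :: "real \<Rightarrow> real"
  assumes "convex_on UNIV f" "\<And>x. f differentiable (at x)"
  shows "mono (deriv f)"
proof (rule monoI)
  fix a b :: real
  assume "a \<le> b"
  have "(deriv f b - deriv f a) * (b - a) \<ge> 0"
    using convex_above_tangent_deriv[OF assms, of a b] convex_above_tangent_deriv[OF assms, of b a]
    by (simp add: algebra_simps)
  then show "deriv f a \<le> deriv f b"
    using \<open>a \<le> b\<close> by (cases "a = b") (auto simp: zero_le_mult_iff)
qed

text \<open>The gap \<open>\<phi>\<close> between the quadratic and \<open>f\<close> vanishes at
  \<open>y\<close>. The Lipschitz bound makes its derivative nonnegative to the right of
  \<open>y\<close> and nonpositive to the left, so \<open>y\<close> minimizes it.\<close>

lemma L_smooth_upper_bound:
  assumes "L_smooth L f"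
  shows "f z \<le> f y + deriv f y * (z - y) + L / 2 * (z - y)\<^sup>2"
proof -
  define \<phi> where "\<phi> = (\<lambda>u. f y + deriv f y * (u - y) + L / 2 * (u - y)\<^sup>2 - f u)"
  have lip: "\<bar>deriv f a - deriv f b\<bar> \<le> L * \<bar>a - b\<bar>" for a b
    using assms by (simp add: L_smooth_def)
  have "(f has_real_derivative deriv f u) (at u)" for u
    using assms by (simp add: L_smooth_def DERIV_deriv_iff_real_differentiable)
  then have der: "(\<phi> has_real_derivative (deriv f y + L * (u - y) - deriv f u)) (at u)" for u
    unfolding \<phi>_def by (auto intro!: derivative_eq_intros)
  have "\<phi> z \<ge> \<phi> y"
  proof (cases "y \<le> z")
    case True
    moreover have "deriv f y + L * (u - y) - deriv f u \<ge> 0" if "y \<le> u" for u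
      using lip[of u y] that by simp
    ultimately show ?thesis
      using der by (intro DERIV_nonneg_imp_nondecreasing[of y z \<phi>]) blast+
  next
    case False
    moreover have "deriv f y + L * (u - y) - deriv f u \<le> 0" if "u \<le> y" for u
      using lip[of u y] that by (simp add: algebra_simps)
    ultimately show ?thesis
      using der by (intro DERIV_nonpos_imp_nonincreasing[of z y \<phi>]) force+
  qed
  then show ?thesis by (simp add: \<phi>_def)
qed

lemma gradient_step_bound:
  assumes "convex_on UNIV f" "L_smooth L f"
  shows "f (grad_step f L y) \<le> f z + deriv f y * (y - z) - (deriv f y)\<^sup>2 / (2 * L)"
proof -
  \<comment> \<open>When \<open>L = 0\<close>, division by zero yields 0: the step stays at
    \<open>y\<close> and the quadratic term vanishes.\<close>
  have "f (grad_step f L y) \<le> f y - (deriv f y)\<^sup>2 / (2 * L)"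
    using L_smooth_upper_bound[OF assms(2), of "grad_step f L y" y]
    by (cases "L = 0") (simp_all add: grad_step_def field_simps power2_eq_square)
  moreover have "f y \<le> f z + deriv f y * (y - z)"
    using convex_above_tangent_deriv[OF assms(1), of y z] assms(2)
    by (simp add: L_smooth_def algebra_simps)
  ultimately show ?thesis by simp
qed

section \<open>A single phase\<close>

text \<open>The coefficient \<open>j / (j + 3)\<close> is \<open>(t j - 1) / t (j + 1)\<close> for \<open>t j = (j + 2) / 2\<close>, and
  \<open>h\<close> stands for \<open>deriv f\<close> scaled by \<open>1 / L\<close>.\<close>

definition momentum_phase ::
  "(real \<Rightarrow> real) \<Rightarrow> (nat \<Rightarrow> real) \<Rightarrow> (nat \<Rightarrow> real) \<Rightarrow> nat \<Rightarrow> bool" where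
  "momentum_phase h X Y m \<longleftrightarrow>
     Y 0 = X 0 \<and>
     (\<forall>j\<le>m. X (Suc j) = Y j - h (Y j)) \<and>
     (\<forall>j<m. Y (Suc j) = X (Suc j) + real j / (real j + 3) * (X (Suc j) - X j)) \<and>
     (\<forall>j<m. h (Y j) * (X (Suc j) - X j) \<le> 0) \<and>
     (\<forall>j\<le>m. h (X j) \<noteq> 0)"

section \<open>Contraction of the distance to the minimizer over one phase\<close>

text \<open>Since \<open>d j / (j + 3)\<close> is nonincreasing, each \<open>d i\<close> is at least
  \<open>(i + 3) / (n + 3) * d n\<close>. Summing \<open>i + 3\<close> over \<open>i \<le> n\<close>
  gives \<open>(n + 1) * (n + 6) / 2\<close>, half of \<open>6 + n * (n + 7)\<close>, which exceeds
  \<open>n * (n + 4) / 2\<close>.\<close>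

lemma momentum_last_increment:
  fixes d g :: "nat \<Rightarrow> real"
  assumes d0: "d 0 = g 0"
    and dSuc: "\<And>j. Suc j \<le> n \<Longrightarrow> d (Suc j) = real j / (real j + 3) * d j + g (Suc j)"
    and g: "\<And>j. Suc j \<le> n \<Longrightarrow> g (Suc j) \<le> g j"
    and gpos: "\<And>j. j \<le> n \<Longrightarrow> 0 \<le> g j"
  shows "real n / (real n + 3) * d n \<le> 2 / (real n + 4) * (\<Sum>j\<le>n. d j)"
proof -
  \<comment> \<open>For constant \<open>g\<close> the recurrence has the solution
    \<open>g * (j + 3) / 4\<close>, hence the constant 4. Together with the recurrence, the bound
    yields \<open>d (j + 1) \<le> (j + 4) / (j + 3) * d j\<close>.\<close>
  have grow: "(real j + 3) * g j \<le> 4 * d j \<and> d j \<ge> 0" if "j \<le> n" for j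
    using that
  proof (induction j)
    case 0
    then show ?case using d0 gpos[of 0] by simp
  next
    case (Suc j)
    then have "(real j + 3) * g (Suc j) \<le> 4 * d j" "d j \<ge> 0"
      using g[of j] by (auto intro: order_trans[OF mult_left_mono])
    moreover from this(1) have "real j * g (Suc j) \<le> real j / (real j + 3) * (4 * d j)"
      using mult_left_mono[of "(real j + 3) * g (Suc j)" "4 * d j" "real j / (real j + 3)"]
      by simp
    ultimately show ?case
      using dSuc[of j] gpos[of "Suc j"] Suc.prems by (simp add: algebra_simps)
  qed
  have sum: "(6 + real j * (real j + 7)) * d j \<le> 2 * (real j + 3) * (\<Sum>i\<le>j. d i)"
    if "j \<le> n" for j
    using that
  proof (induction j)
    case 0
    then show ?case using grow[of 0] by simp
  next
    case (Suc j)
    define c where "c = 6 + real j * (real j + 7)"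
    have c: "c > 0" by (simp add: c_def add_pos_nonneg)
    have IH: "c * d j \<le> 2 * (real j + 3) * (\<Sum>i\<le>j. d i)"
      using Suc by (simp add: c_def)
    have "(real j + 3) * g (Suc j) \<le> 4 * d j"
      using grow[of j] g[of j] Suc.prems by (auto intro: order_trans[OF mult_left_mono])
    then have "(real j + 3) * d (Suc j) \<le> (real j + 4) * d j"
      using dSuc[of j] Suc.prems by (simp add: field_simps)
    then have "c * ((real j + 3) * d (Suc j)) \<le> (real j + 4) * (c * d j)"
      using c by (simp add: mult.left_commute)
    also have "\<dots> \<le> (real j + 4) * (2 * (real j + 3) * (\<Sum>i\<le>j. d i))"
      using IH by (intro mult_left_mono) auto
    finally have "(real j + 3) * (c * d (Suc j)) \<le> (real j + 3) * (2 * (real j + 4) * (\<Sum>i\<le>j. d i))"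
      by (simp only: mult_ac)
    then have "c * d (Suc j) \<le> 2 * (real j + 4) * (\<Sum>i\<le>j. d i)"
      by (rule mult_left_le_imp_le) simp
    then show ?case by (simp add: c_def algebra_simps)
  qed
  define s where "s = (\<Sum>i\<le>n. d i)"
  have "real n * (real n + 4) * d n \<le> (6 + real n * (real n + 7)) * d n"
    using grow[of n] by (intro mult_right_mono) (auto simp: algebra_simps)
  also have "\<dots> \<le> 2 * (real n + 3) * s"
    using sum[of n] by (simp add: s_def)
  finally show ?thesis
    unfolding s_def[symmetric] by (simp add: field_simps)
qed

text \<open>While the iterates increase, the absence of a restart forces
  \<open>h (Y j) \<le> 0\<close> and keeps them at or left of \<open>s\<close>. The restart forces
  \<open>Y m > s\<close>, and \<open>X (Suc m)\<close> then lies between \<open>s\<close> and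
  \<open>Y m\<close>, so the overshoot is controlled by the last momentum term.\<close>

lemma momentum_phase_contraction_left:
  assumes ph: "momentum_phase h X Y m"
    and mono: "mono h"
    and lip: "\<And>a b. a \<le> b \<Longrightarrow> h b - h a \<le> b - a"
    and hs: "h s = 0"
    and restart: "h (Y m) * (X (Suc m) - X m) > 0"
    and X0: "X 0 < s"
  shows "m \<ge> 2 \<and> \<bar>X (Suc m) - s\<bar> \<le> 2 / (real m + 3) * \<bar>X 0 - s\<bar>"
proof -
  note ph = ph[unfolded momentum_phase_def]
  have step: "X (Suc j) = Y j - h (Y j)" if "j \<le> m" for j
    using ph that by blast
  have mom: "Y (Suc j) = X (Suc j) + real j / (real j + 3) * (X (Suc j) - X j)" if "j < m" for j
    using ph that by blast
  have norestart: "h (Y j) * (X (Suc j) - X j) \<le> 0" if "j < m" for j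
    using ph that by blast
  have nz: "h (X j) \<noteq> 0" if "j \<le> m" for j
    using ph that by blast
  have neg: "h u < 0" if "u \<le> s" "h u \<noteq> 0" for u
    using monoD[OF mono that(1)] hs that(2) by simp
  \<comment> \<open>By \<open>lip\<close> the map \<open>u - h u\<close> is nondecreasing, so its
    value at \<open>Y j\<close> is at least its value at \<open>X j\<close>, which exceeds
    \<open>X j\<close> because \<open>h (X j) < 0\<close>.\<close>
  have forward: "X j < X (Suc j)" if "j \<le> m" "X j \<le> s" "X j \<le> Y j" for j
    using lip[OF that(3)] neg[OF that(2) nz[OF that(1)]] step[OF that(1)] by simp
  have left: "X j \<le> s \<and> X j \<le> Y j \<and> (\<forall>i<j. h (Y i) \<le> 0)" if "j \<le> m" for j
    using that
  proof (induction j)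
    case 0
    then show ?case using ph X0 by simp
  next
    case (Suc j)
    then have IH: "X j \<le> s" "X j \<le> Y j" "\<forall>i<j. h (Y i) \<le> 0" by auto
    have less: "X j < X (Suc j)" using forward Suc.prems IH by simp
    have hY: "h (Y j) \<le> 0"
      using norestart[of j] less Suc.prems by (auto simp: mult_le_0_iff)
    \<comment> \<open>Beyond \<open>s\<close>, \<open>h (Y j)\<close> could only be 0; then
      \<open>X (Suc j) = Y j\<close> would be a zero of \<open>h\<close>, although the phase
      continues at \<open>Suc j\<close>.\<close>
    have Y: "Y j \<le> s"
    proof (rule ccontr)
      assume "\<not> Y j \<le> s"
      then have "h (Y j) = 0" using hY monoD[OF mono, of s "Y j"] hs by simp
      then show False using nz[of "Suc j"] step[of j] Suc.prems by simp
    qed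
    have "X (Suc j) \<le> s" using lip[OF Y] step[of j] hs Suc.prems by simp
    moreover have "X (Suc j) \<le> Y (Suc j)" using mom[of j] less Suc.prems by simp
    ultimately show ?case using IH(3) hY less_Suc_eq by auto
  qed
  have Xm: "X m < s" using left[of m] nz[of m] hs by (cases "X m = s") auto
  have "X m < X (Suc m)" using forward[of m] left[of m] by simp
  then have hYm: "h (Y m) > 0" using restart by (simp add: zero_less_mult_iff)
  then have Ym: "Y m > s" using monoD[OF mono, of "Y m" s] hs by (cases "Y m \<le> s") auto
  have lower: "X (Suc m) \<ge> s" using lip[of s "Y m"] Ym step[of m] hs by simp
  \<comment> \<open>The momentum coefficient is 0 at local index 0, so \<open>Y\<close> and
    \<open>X\<close> agree at indices 0 and 1; both are thereby excluded for
    \<open>m\<close>.\<close>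
  have hXm: "Y m \<noteq> X m" using Ym Xm by simp
  have "m \<noteq> 0" using hXm ph by metis
  moreover have "m \<noteq> 1" using hXm mom[of 0] by auto
  ultimately have m: "m \<ge> 2" by simp
  \<comment> \<open>The momentum in \<open>Y m\<close> comes from the increment \<open>d n\<close>
    with \<open>n = m - 1\<close>; thus \<open>2 / (n + 4)\<close> is
    \<open>2 / (m + 3)\<close>.\<close>
  define n where "n = m - 1"
  have mn: "m = Suc n" using m by (simp add: n_def)
  define d where "d = (\<lambda>j. X (Suc j) - X j)"
  define g where "g = (\<lambda>j. - h (Y j))"
  have "real n / (real n + 3) * d n \<le> 2 / (real n + 4) * (\<Sum>j\<le>n. d j)"
  proof (rule momentum_last_increment)
    show "d 0 = g 0" using step[of 0] ph by (simp add: d_def g_def)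
    show "d (Suc j) = real j / (real j + 3) * d j + g (Suc j)" if "Suc j \<le> n" for j
      using step[of "Suc j"] mom[of j] that mn by (simp add: d_def g_def)
    show "0 \<le> g j" if "j \<le> n" for j
      using left[of m] that mn by (simp add: g_def)
    show "g (Suc j) \<le> g j" if "Suc j \<le> n" for j
    proof -
      have "Y j \<le> X (Suc j)" using left[of m] step[of j] that mn by simp
      also have "\<dots> \<le> Y (Suc j)" using left[of "Suc j"] that mn by simp
      finally show ?thesis using monoD[OF mono] by (simp add: g_def)
    qed
  qed
  moreover have "(\<Sum>j\<le>n. d j) = X m - X 0"
    using sum_telescope[of X n] sum_negf[of "\<lambda>j. X j - X (Suc j)" "{..n}"] mn by (simp add: d_def)
  ultimately have "real n / (real n + 3) * d n \<le> 2 / (real m + 3) * (X m - X 0)"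
    using mn by (simp add: add.commute)
  moreover have "X (Suc m) \<le> X m + real n / (real n + 3) * d n"
    using step[of m] hYm mom[of n] mn by (simp add: d_def)
  moreover have "2 / (real m + 3) * (X m - X 0) \<le> 2 / (real m + 3) * (s - X 0)"
    using Xm by (intro mult_left_mono) auto
  ultimately have "X (Suc m) - s \<le> 2 / (real m + 3) * (s - X 0)"
    using Xm by simp
  then show ?thesis using lower X0 m by simp
qed

text \<open>A start to the right of \<open>s\<close> is reduced to one on the left by the reflection
  \<open>u\<close> to \<open>- u\<close>, which preserves monotonicity, the Lipschitz bound and the
  restart condition.\<close>

lemma momentum_phase_contraction:
  assumes ph: "momentum_phase h X Y m"
    and mono: "mono h"
    and lip: "\<And>a b. a \<le> b \<Longrightarrow> h b - h a \<le> b - a"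
    and hs: "h s = 0"
    and restart: "h (Y m) * (X (Suc m) - X m) > 0"
  shows "m \<ge> 2 \<and> \<bar>X (Suc m) - s\<bar> \<le> 2 / (real m + 3) * \<bar>X 0 - s\<bar>"
proof -
  have "h (X 0) \<noteq> 0" using ph by (simp add: momentum_phase_def)
  then consider "X 0 < s" | "X 0 > s" using hs by fastforce
  then show ?thesis
  proof cases
    case 1
    then show ?thesis using momentum_phase_contraction_left[OF assms] by blast
  next
    case 2
    let ?h = "\<lambda>u. - h (- u)" and ?X = "\<lambda>j. - X j" and ?Y = "\<lambda>j. - Y j"
    have "m \<ge> 2 \<and> \<bar>?X (Suc m) - (- s)\<bar> \<le> 2 / (real m + 3) * \<bar>?X 0 - (- s)\<bar>"
    proof (rule momentum_phase_contraction_left)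
      show "momentum_phase ?h ?X ?Y m"
        using ph by (auto simp: momentum_phase_def algebra_simps diff_divide_distrib)
      show "mono ?h" using mono by (auto simp: mono_def)
      show "?h b - ?h a \<le> b - a" if "a \<le> b" for a b
        using lip[of "- b" "- a"] that by simp
      show "?h (- s) = 0" using hs by simp
      show "?h (?Y m) * (?X (Suc m) - ?X m) > 0" using restart by (simp add: algebra_simps)
      show "?X 0 < - s" using 2 by simp
    qed
    then show ?thesis by (simp add: abs_minus_commute)
  qed
qed

section \<open>Decay of the function values within one phase\<close>

text \<open>The energy \<open>E\<close> of accelerated gradient descent does not increase along the
  phase. The case \<open>n = m\<close> is included: a restart at \<open>m\<close> acts only after
  the gradient step that produces \<open>X (Suc m)\<close>.\<close>

lemma momentum_phase_value_bound:
  fixes f :: "real \<Rightarrow> real"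
  assumes conv: "convex_on UNIV f" and L: "L > 0" and smooth: "L_smooth L f"
    and min: "\<And>u. f s \<le> f u"
    and ph: "momentum_phase (\<lambda>u. deriv f u / L) X Y m"
    and "n \<le> m"
  shows "f (X (Suc n)) - f s \<le> (2 / (real n + 2))\<^sup>2 * (L / 2) * (X 0 - s)\<^sup>2"
proof -
  define t where "t = (\<lambda>j. (real j + 2) / 2)"
  define E where "E = (\<lambda>j. (t j)\<^sup>2 * (f (X (Suc j)) - f s)
    + L / 2 * (X j + t j * (X (Suc j) - X j) - s)\<^sup>2)"
  note ph = ph[unfolded momentum_phase_def]
  have step: "t j ^ 2 * (f (X (Suc j)) - f s) + L / 2 * (X j + t j * (X (Suc j) - X j) - s)\<^sup>2
     \<le> t j * (t j - 1) * (f (X j) - f s) + L / 2 * (X j + t j * (Y j - X j) - s)\<^sup>2" if "j \<le> m" for j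
  proof -
    define g where "g = deriv f (Y j) / L"
    have Lg: "deriv f (Y j) = L * g" using L by (simp add: g_def)
    have X: "X (Suc j) = Y j - g" using ph that by (simp add: g_def)
    have bound: "f (X (Suc j)) \<le> f z + L * g * (Y j - z) - L / 2 * g\<^sup>2" for z
    proof -
      have "grad_step f L (Y j) = X (Suc j)" by (simp add: grad_step_def X g_def)
      moreover have "(L * g)\<^sup>2 / (2 * L) = L / 2 * g\<^sup>2" using L by (simp add: power2_eq_square)
      ultimately show ?thesis
        using gradient_step_bound[OF conv smooth, of "Y j" z] by (simp add: Lg)
    qed
    have t: "t j \<ge> 1" by (simp add: t_def)
    \<comment> \<open>The gradient step bound is used at \<open>X j\<close> and at \<open>s\<close>
      with the convex weights \<open>(t j - 1) / t j\<close> and \<open>1 / t j\<close>, scaled by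
      \<open>(t j)\<^sup>2\<close>. With these weights the terms in \<open>g\<close> form a
      difference of two squares.\<close>
    have 1: "t j * (t j - 1) * f (X (Suc j)) \<le> t j * (t j - 1) * (f (X j) + L * g * (Y j - X j) - L / 2 * g\<^sup>2)"
      using t bound by (intro mult_left_mono) auto
    have 2: "t j * f (X (Suc j)) \<le> t j * (f s + L * g * (Y j - s) - L / 2 * g\<^sup>2)"
      using t bound by (intro mult_left_mono) auto
    have "t j ^ 2 * (f (X (Suc j)) - f s) =
        t j * (t j - 1) * f (X (Suc j)) + t j * f (X (Suc j)) - t j ^ 2 * f s"
      by (simp add: algebra_simps power2_eq_square)
    also have "\<dots> \<le> t j * (t j - 1) * (f (X j) + L * g * (Y j - X j) - L / 2 * g\<^sup>2)
        + t j * (f s + L * g * (Y j - s) - L / 2 * g\<^sup>2) - t j ^ 2 * f s"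
      using 1 2 by simp
    also have "\<dots> = t j * (t j - 1) * (f (X j) - f s) + L / 2 * (X j + t j * (Y j - X j) - s)\<^sup>2
        - L / 2 * (X j + t j * (X (Suc j) - X j) - s)\<^sup>2"
      unfolding X by (simp add: field_simps power2_eq_square)
    finally show ?thesis by simp
  qed
  \<comment> \<open>At index 0, \<open>t 0 = 1\<close> removes the function value and
    \<open>Y 0 = X 0\<close> leaves the initial squared distance.\<close>
  have E: "E j \<le> L / 2 * (X 0 - s)\<^sup>2" if "j \<le> m" for j
    using that
  proof (induction j)
    case 0
    then show ?case using step[of 0] ph by (simp add: E_def t_def)
  next
    case (Suc j)
    have "t (Suc j) * (t (Suc j) - 1) \<le> (t j)\<^sup>2"
      by (simp add: t_def power2_eq_square field_simps)
    then have "t (Suc j) * (t (Suc j) - 1) * (f (X (Suc j)) - f s) \<le> (t j)\<^sup>2 * (f (X (Suc j)) - f s)"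
      using min by (intro mult_right_mono) auto
    \<comment> \<open>The momentum coefficient is chosen so that the square left by one step is the
      square with which the next begins.\<close>
    moreover have "X (Suc j) + t (Suc j) * (Y (Suc j) - X (Suc j)) = X j + t j * (X (Suc j) - X j)"
    proof -
      have "Y (Suc j) = X (Suc j) + real j / (real j + 3) * (X (Suc j) - X j)"
        using ph Suc.prems by auto
      moreover have "t (Suc j) * (real j / (real j + 3)) = t j - 1"
        by (simp add: t_def field_simps)
      ultimately have "t (Suc j) * (Y (Suc j) - X (Suc j)) = (t j - 1) * (X (Suc j) - X j)"
        by (metis add_diff_cancel_left' mult.assoc)
      then show ?thesis by (simp add: algebra_simps)
    qed
    ultimately have "E (Suc j) \<le> E j"
      using step[OF Suc.prems] by (simp add: E_def)
    then show ?case using Suc by simp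
  qed
  have "(t n)\<^sup>2 * (f (X (Suc n)) - f s) \<le> E n" using L by (simp add: E_def)
  also have "\<dots> \<le> L / 2 * (X 0 - s)\<^sup>2" using E \<open>n \<le> m\<close> by blast
  finally have "f (X (Suc n)) - f s \<le> L / 2 * (X 0 - s)\<^sup>2 / (t n)\<^sup>2"
    by (subst pos_le_divide_eq) (auto simp: t_def mult.commute)
  then show ?thesis by (simp add: t_def power_divide)
qed

section \<open>Counting restarts\<close>

lemma is_nth_restart_lessI:
  assumes "is_nth_restart f x y q a" "is_nth_restart f x y q' b" "q < q'"
  shows "a < b"
proof (rule ccontr)
  assume "\<not> a < b"
  then have "{j. j \<le> b \<and> restart_at f x y j} \<subseteq> {j. j \<le> a \<and> restart_at f x y j}" by auto
  then have "q' \<le> q"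
    using assms(1,2) card_mono[of "{j. j \<le> a \<and> restart_at f x y j}" "{j. j \<le> b \<and> restart_at f x y j}"]
    by (simp add: is_nth_restart_def)
  then show False using assms(3) by simp
qed

lemma not_restart_before_first:
  assumes "is_nth_restart f x y 1 b" "j < b"
  shows "\<not> restart_at f x y j"
proof
  assume "restart_at f x y j"
  then have "{j, b} \<subseteq> {i. i \<le> b \<and> restart_at f x y i}"
    using assms by (auto simp: is_nth_restart_def)
  then have "card {j, b} \<le> 1"
    using assms(1) card_mono[of "{i. i \<le> b \<and> restart_at f x y i}" "{j, b}"]
    by (simp add: is_nth_restart_def)
  then show False using assms(2) by simp
qed

text \<open>Such a \<open>j\<close>, together with \<open>b\<close>, would add two restarts to the
  \<open>q\<close> counted up to \<open>a\<close>, but only one more is counted up to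
  \<open>b\<close>.\<close>

lemma not_restart_between:
  assumes "is_nth_restart f x y q a" "is_nth_restart f x y (Suc q) b" "a < j" "j < b"
  shows "\<not> restart_at f x y j"
proof
  assume "restart_at f x y j"
  let ?A = "{i. i \<le> a \<and> restart_at f x y i}"
  have "?A \<union> {j, b} \<subseteq> {i. i \<le> b \<and> restart_at f x y i}"
    using assms \<open>restart_at f x y j\<close> by (auto simp: is_nth_restart_def)
  then have "card (?A \<union> {j, b}) \<le> Suc q"
    using assms(2) card_mono[of "{i. i \<le> b \<and> restart_at f x y i}" "?A \<union> {j, b}"]
    by (simp add: is_nth_restart_def)
  moreover have "card (?A \<union> {j, b}) = card ?A + card {j, b}"
    using assms by (intro card_Un_disjoint) auto
  ultimately show False using assms by (simp add: is_nth_restart_def)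
qed

section \<open>The phases of the algorithm\<close>

text \<open>Fixes a witness \<open>t\<close> for the existential parameter table, so that all phases
  are analysed with the same one.\<close>

locale restarted_agd_run =
  fixes f :: "real \<Rightarrow> real" and L :: real and x y :: "nat \<Rightarrow> real" and t :: "nat \<Rightarrow> nat \<Rightarrow> real"
  assumes L: "L > 0"
    and y0: "y 0 = x 0"
    and t0: "t 0 = (\<lambda>i. (real i + 2) / 2)"
    and iteration: "\<And>k. carried_out f x k \<Longrightarrow>
           x (Suc k) = grad_step f L (y k) \<and>
           (if deriv f (y k) * (x (Suc k) - x k) \<le> 0
            then y (Suc k) = x (Suc k) + (t k k - 1) / t k (Suc k) * (x (Suc k) - x k) \<and>
                 t (Suc k) = t k
            else y (Suc k) = x (Suc k) \<and>
                 t (Suc k) = (\<lambda>i. if Suc k \<le> i then (real (i - Suc k) + 2) / 2 else t k i))"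
begin

text \<open>Marks \<open>a\<close> as the start of a phase. It describes only the state at
  \<open>a\<close>, so the initial phase and those after restarts are treated alike.\<close>

definition fresh :: "nat \<Rightarrow> bool" where
  "fresh a \<longleftrightarrow> y a = x a \<and> (\<forall>i. t a (a + i) = (real i + 2) / 2)"

lemma fresh_0: "fresh 0"
  using y0 t0 by (simp add: fresh_def)

lemma fresh_after_restart:
  assumes "restart_at f x y k"
  shows "fresh (Suc k)"
  using assms iteration[of k] by (auto simp: fresh_def restart_at_def)

lemma momentum_phase_fresh:
  assumes "fresh a" "carried_out f x (a + m)"
    and no: "\<And>j. j < m \<Longrightarrow> \<not> restart_at f x y (a + j)"
  shows "momentum_phase (\<lambda>u. deriv f u / L) (\<lambda>j. x (a + j)) (\<lambda>j. y (a + j)) m"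
proof -
  have car: "carried_out f x (a + j)" if "j \<le> m" for j
    using assms(2) that by (auto simp: carried_out_def)
  \<comment> \<open>Negating \<open>restart_at\<close> yields this sign because iteration
    \<open>a + j\<close> is known to be carried out.\<close>
  have cond: "deriv f (y (a + j)) * (x (Suc (a + j)) - x (a + j)) \<le> 0" if "j < m" for j
    using no[OF that] car[of j] that by (auto simp: restart_at_def)
  \<comment> \<open>Only a restart changes the table, so the whole phase reads its parameters from
    \<open>t a\<close>, indexed by local time.\<close>
  have t: "t (a + j) = t a" if "j \<le> m" for j
    using that
  proof (induction j)
    case (Suc j)
    then show ?case using iteration[OF car[of j]] cond[of j] by simp
  qed simp
  have mom: "y (Suc (a + j)) = x (Suc (a + j)) + real j / (real j + 3) * (x (Suc (a + j)) - x (a + j))"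
    if "j < m" for j
  proof -
    have "t (a + j) (a + j) = (real j + 2) / 2" "t (a + j) (a + Suc j) = (real (Suc j) + 2) / 2"
      using assms(1) t[of j] that unfolding fresh_def by (metis less_imp_le_nat)+
    then have "(t (a + j) (a + j) - 1) / t (a + j) (Suc (a + j)) = real j / (real j + 3)"
      unfolding add_Suc_right by (simp only:) (simp add: field_simps)
    then show ?thesis
      using iteration[OF car[of j]] cond[of j] that by simp
  qed
  show ?thesis
    unfolding momentum_phase_def
  proof (intro conjI allI impI)
    show "y (a + 0) = x (a + 0)" using assms(1) by (simp add: fresh_def)
  next
    fix j assume "j \<le> m"
    then show "x (a + Suc j) = y (a + j) - deriv f (y (a + j)) / L"
      using iteration[OF car] by (simp add: grad_step_def)
  next
    fix j assume "j < m"
    then show "y (a + Suc j) = x (a + Suc j) + real j / (real j + 3) * (x (a + Suc j) - x (a + j))"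
      using mom by simp
  next
    fix j assume "j < m"
    then show "deriv f (y (a + j)) / L * (x (a + Suc j) - x (a + j)) \<le> 0"
      using cond[of j] L by (simp add: divide_le_0_iff)
  next
    fix j assume "j \<le> m"
    then show "deriv f (x (a + j)) / L \<noteq> 0"
      using assms(2) L by (simp add: carried_out_def)
  qed
qed

lemma phase_contraction:
  assumes conv: "convex_on UNIV f" and smooth: "L_smooth L f" and s: "deriv f s = 0"
    and fresh: "fresh a" and "a \<le> b"
    and no: "\<And>j. a \<le> j \<Longrightarrow> j < b \<Longrightarrow> \<not> restart_at f x y j"
    and b: "restart_at f x y b"
  shows "b \<ge> a + 2 \<and> \<bar>x (Suc b) - s\<bar> \<le> 2 / (real b - real a + 3) * \<bar>x a - s\<bar>"
proof -
  define m where "m = b - a"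
  have bm: "b = a + m" using \<open>a \<le> b\<close> by (simp add: m_def)
  have "m \<ge> 2 \<and> \<bar>x (a + Suc m) - s\<bar> \<le> 2 / (real m + 3) * \<bar>x (a + 0) - s\<bar>"
  proof (rule momentum_phase_contraction)
    show "momentum_phase (\<lambda>u. deriv f u / L) (\<lambda>j. x (a + j)) (\<lambda>j. y (a + j)) m"
      using b no by (intro momentum_phase_fresh fresh) (auto simp: bm restart_at_def)
    show "mono (\<lambda>u. deriv f u / L)"
      using convex_deriv_mono[OF conv] smooth L
      by (auto simp: mono_def L_smooth_def divide_right_mono)
    show "deriv f v / L - deriv f u / L \<le> v - u" if "u \<le> v" for u v
    proof -
      have "\<bar>deriv f v - deriv f u\<bar> \<le> L * \<bar>v - u\<bar>" using smooth by (simp add: L_smooth_def)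
      then have "deriv f v - deriv f u \<le> L * (v - u)" using that by simp
      then show ?thesis using L by (simp add: field_simps)
    qed
    show "deriv f s / L = 0" using s by simp
    show "deriv f (y (a + m)) / L * (x (a + Suc m) - x (a + m)) > 0"
      using b L by (simp add: restart_at_def bm)
  qed
  then show ?thesis by (simp add: bm)
qed

end

section \<open>Composition of the phases\<close>

text \<open>Turns the product of phase lengths into linear growth: a new gap \<open>n\<close>
  contributes the factor \<open>n + 2\<close>, which outweighs a doubling together with the growth
  of \<open>r p + 3\<close> by \<open>n\<close>. The induction starts at 2 since the inequality
  fails for \<open>p = 1\<close>.\<close>

lemma restart_product_lower_bound:
  fixes r :: "nat \<Rightarrow> nat"
  assumes "p \<ge> 2" "r 1 \<ge> 2" and "\<And>q. 1 \<le> q \<Longrightarrow> q < p \<Longrightarrow> r q + 3 \<le> r (Suc q)"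
  shows "2 ^ p * (real (r p) + 3) \<le>
    2 * ((\<Prod>i = 2..p. real (r i) - real (r (i - 1)) + 2) * (real (r 1) + 2))"
  using assms
proof (induction p rule: dec_induct)
  case base
  define n where "n = real (r 2) - real (r 1)"
  have "r 1 + 3 \<le> r 2" using base.prems(2)[of 1] by (simp add: numeral_2_eq_2)
  then have "n \<ge> 3" by (simp add: n_def)
  then have "n * real (r 1) \<ge> 3 * 2" using base by (intro mult_mono) auto
  moreover have "real (r 2) = real (r 1) + n" by (simp add: n_def)
  ultimately show ?case by (simp add: algebra_simps)
next
  case (step p)
  define B where "B = (\<Prod>i = 2..p. real (r i) - real (r (i - 1)) + 2) * (real (r 1) + 2)"
  define n where "n = real (r (Suc p)) - real (r p)"
  have n: "n \<ge> 3" using step.prems(2)[of p] step.hyps by (simp add: n_def)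
  have IH: "2 ^ p * (real (r p) + 3) \<le> 2 * B"
    using step.IH step.prems unfolding B_def by simp
  have "2 * (real (r p) + n + 3) \<le> (real (r p) + 3) * (n + 2)"
    using n by (simp add: algebra_simps)
  then have "2 ^ p * (2 * (real (r p) + n + 3)) \<le> 2 ^ p * ((real (r p) + 3) * (n + 2))"
    by (intro mult_left_mono) auto
  also have "\<dots> \<le> 2 * B * (n + 2)"
    using mult_right_mono[OF IH, of "n + 2"] n by (simp add: mult.assoc)
  finally have "2 ^ Suc p * (real (r (Suc p)) + 3) \<le> 2 * ((n + 2) * B)"
    by (simp add: n_def algebra_simps)
  moreover have "(\<Prod>i = 2..Suc p. real (r i) - real (r (i - 1)) + 2) =
      (\<Prod>i = 2..p. real (r i) - real (r (i - 1)) + 2) * (n + 2)"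
    using step.hyps by (simp add: n_def)
  ultimately show ?case by (simp add: B_def mult_ac)
qed

theorem theorem9:
  fixes f :: "real \<Rightarrow> real" and L x0 xstar :: real and S :: "real set"
    and x y :: "nat \<Rightarrow> real" and r :: "nat \<Rightarrow> nat" and p k :: nat
  assumes "convex_on UNIV f"
    and "L > 0"
    and "L_smooth L f"
    and "S = argmin_set f"
    and "S \<noteq> {}"
    and "xstar = closest_point S x0"
    and "generated_by_restarted_agd f L (\<lambda>i. (real i + 2) / 2) x0 x y"
    and "p \<ge> 2"
    and "\<And>q. 1 \<le> q \<Longrightarrow> q \<le> p + 1 \<Longrightarrow> is_nth_restart f x y q (r q)"
    and "k \<in> {r p + 2 .. r (p + 1) + 1}"
  shows "f (x k) - f xstar
           \<le> (2 ^ (p + 1) /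
               ((real k - real (r p)) * (\<Prod>i = 2..p. real (r i) - real (r (i - 1)) + 2) *
                (real (r 1) + 2)))\<^sup>2 * (L / 2) * (x0 - xstar)\<^sup>2
       \<and> (2 ^ (p + 1) /
               ((real k - real (r p)) * (\<Prod>i = 2..p. real (r i) - real (r (i - 1)) + 2) *
                (real (r 1) + 2)))\<^sup>2 * (L / 2) * (x0 - xstar)\<^sup>2
           \<le> 2 * L * (x0 - xstar)\<^sup>2 / (real k + 1)\<^sup>2"
proof -
  note conv = assms(1) and L = assms(2) and smooth = assms(3) and nth = assms(9)
  have diff: "f differentiable (at u)" for u
    using smooth by (simp add: L_smooth_def)
  have S: "S = {u. \<forall>v. f u \<le> f v}"
    using assms(4) by (auto simp: argmin_set_def is_arg_min_def not_less)
  have "continuous_on UNIV f"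
    using diff by (simp add: continuous_at_imp_continuous_on differentiable_imp_continuous_within)
  then have "closed S"
    unfolding S by (intro closed_Collect_all closed_Collect_le continuous_intros) auto
  then have "xstar \<in> S"
    using assms(5,6) closest_point_in_set by blast
  then have min: "f xstar \<le> f u" for u
    using S by blast
  have crit: "deriv f xstar = 0"
    using DERIV_local_min[of f "deriv f xstar" xstar 1] min diff
    by (simp add: DERIV_deriv_iff_real_differentiable)
  obtain t where "restarted_agd_run f L x y t" and x0: "x 0 = x0"
    using assms(7) L unfolding generated_by_restarted_agd_def restarted_agd_run_def by blast
  then interpret restarted_agd_run f L x y t by simp
  have restart: "restart_at f x y (r q)" if "1 \<le> q" "q \<le> p + 1" for q
    using nth[OF that] by (simp add: is_nth_restart_def)
  have first: "r 1 \<ge> 2 \<and> \<bar>x (Suc (r 1)) - xstar\<bar> \<le> 2 / (real (r 1) + 3) * \<bar>x0 - xstar\<bar>"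
    using phase_contraction[OF conv smooth crit fresh_0, of "r 1"] restart[of 1]
      not_restart_before_first[OF nth[of 1]] x0 by auto
  have less: "r q < r (Suc q)" if "1 \<le> q" "q \<le> p" for q
    using that by (intro is_nth_restart_lessI[OF nth nth]) auto
  have no: "\<not> restart_at f x y j" if "1 \<le> q" "q \<le> p" "r q < j" "j < r (Suc q)" for q j
    using not_restart_between[OF nth[of q] nth[of "Suc q"]] that by auto
  \<comment> \<open>The phase starts at \<open>Suc (r q)\<close>, one after the restart. Hence the
    \<open>+ 3\<close> of \<open>phase_contraction\<close> becomes \<open>+ 2\<close>, and its
    minimal length 2 becomes a gap of 3.\<close>
  have later: "r q + 3 \<le> r (Suc q) \<and> \<bar>x (Suc (r (Suc q))) - xstar\<bar>
      \<le> 2 / (real (r (Suc q)) - real (r q) + 2) * \<bar>x (Suc (r q)) - xstar\<bar>"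
    if "1 \<le> q" "q \<le> p" for q
    using phase_contraction[OF conv smooth crit fresh_after_restart[OF restart[of q]], of "r (Suc q)"]
      restart[of "Suc q"] no[OF that] less[OF that] that by (simp add: add.commute)
  define B where "B = (\<lambda>q. (\<Prod>i = 2..q. real (r i) - real (r (i - 1)) + 2) * (real (r 1) + 2))"
  have B_Suc: "B (Suc q) = (real (r (Suc q)) - real (r q) + 2) * B q" if "1 \<le> q" for q
    using that by (simp add: B_def mult_ac)
  have dist: "B q > 0 \<and> \<bar>x (Suc (r q)) - xstar\<bar> \<le> 2 ^ q / B q * \<bar>x0 - xstar\<bar>"
    if "1 \<le> q" "q \<le> p" for q
    using that
  proof (induction q rule: dec_induct)
    case base
    \<comment> \<open>The first phase starts at 0 and so gives the stronger factor with
      \<open>+ 3\<close>, weakened here to the claimed one.\<close>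
    have "2 / (real (r 1) + 3) * \<bar>x0 - xstar\<bar> \<le> 2 / (real (r 1) + 2) * \<bar>x0 - xstar\<bar>"
      by (intro mult_right_mono frac_le) auto
    then show ?case using first by (simp add: B_def)
  next
    case (step q)
    define c where "c = real (r (Suc q)) - real (r q) + 2"
    have c: "c > 0" using less[of q] step by (simp add: c_def)
    have "\<bar>x (Suc (r (Suc q))) - xstar\<bar> \<le> 2 / c * \<bar>x (Suc (r q)) - xstar\<bar>"
      using later[of q] step by (simp add: c_def)
    also have "\<dots> \<le> 2 / c * (2 ^ q / B q * \<bar>x0 - xstar\<bar>)"
      using c step by (intro mult_left_mono) auto
    finally show ?case
      using B_Suc[of q] c step by (simp add: c_def[symmetric])
  qed
  have Bp: "B p > 0" using dist[of p] \<open>p \<ge> 2\<close> by simp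
  define a where "a = real k - real (r p)"
  have a: "a \<ge> 2" using assms(10) by (simp add: a_def)
  have "f (x k) - f xstar \<le> (2 / a)\<^sup>2 * (L / 2) * (x (Suc (r p)) - xstar)\<^sup>2"
  proof -
    \<comment> \<open>Local indices in the phase starting at \<open>Suc (r p)\<close>:
      \<open>m\<close> is that of the next restart, and \<open>x k\<close> is produced by the step
      with index \<open>n\<close>, so \<open>n + 2 = k - r p\<close>.\<close>
    define m n where "m = r (p + 1) - Suc (r p)" and "n = k - (r p + 2)"
    have m: "Suc (r p) + m = r (p + 1)" using less[of p] \<open>p \<ge> 2\<close> by (simp add: m_def)
    have k: "k = Suc (r p) + Suc n" using assms(10) unfolding n_def atLeastAtMost_iff by linarith
    have "momentum_phase (\<lambda>u. deriv f u / L) (\<lambda>j. x (Suc (r p) + j)) (\<lambda>j. y (Suc (r p) + j)) m"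
      using restart[of p] restart[of "p + 1"] no[of p] \<open>p \<ge> 2\<close> m
      by (intro momentum_phase_fresh fresh_after_restart) (auto simp: restart_at_def)
    moreover have "n \<le> m" using assms(10) k m by simp
    ultimately have "f (x k) - f xstar \<le> (2 / (real n + 2))\<^sup>2 * (L / 2) * (x (Suc (r p) + 0) - xstar)\<^sup>2"
      unfolding k by (rule momentum_phase_value_bound[OF conv L smooth min])
    moreover have "real n + 2 = a" by (simp add: a_def k)
    ultimately show ?thesis by simp
  qed
  \<comment> \<open>The starting distance of the last phase has already been contracted by the
    \<open>p\<close> preceding phases.\<close>
  also have "\<dots> \<le> (2 / a)\<^sup>2 * (L / 2) * (2 ^ p / B p * \<bar>x0 - xstar\<bar>)\<^sup>2"
    using dist[of p] \<open>p \<ge> 2\<close> L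
    by (intro mult_left_mono power2_le_iff_abs_le[THEN iffD2]) auto
  also have "\<dots> = (2 ^ (p + 1) / (a * B p))\<^sup>2 * (L / 2) * (x0 - xstar)\<^sup>2"
    by (simp add: power_mult_distrib power_divide)
  finally have val: "f (x k) - f xstar \<le> (2 ^ (p + 1) / (a * B p))\<^sup>2 * (L / 2) * (x0 - xstar)\<^sup>2" .
  have rate: "(2 ^ (p + 1) / (a * B p))\<^sup>2 * (L / 2) * (x0 - xstar)\<^sup>2
      \<le> 2 * L * (x0 - xstar)\<^sup>2 / (real k + 1)\<^sup>2"
  proof -
    have "2 ^ p * (real (r p) + 3) \<le> 2 * B p"
      unfolding B_def using first later \<open>p \<ge> 2\<close> by (intro restart_product_lower_bound) auto
    then have "a * (2 ^ p * (real (r p) + 3)) \<le> a * (2 * B p)"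
      using a by (intro mult_left_mono) auto
    then have "2 ^ p * (a * (real (r p) + 3)) \<le> 2 * (a * B p)"
      by (simp only: mult.left_commute)
    \<comment> \<open>With \<open>k = a + r p\<close> this is
      \<open>(a - 2) * (r p + 1) \<ge> 0\<close>.\<close>
    moreover have "2 * (real k + 1) \<le> a * (real (r p) + 3)"
    proof -
      have "2 * (real (r p) + 1) \<le> a * (real (r p) + 1)" using a by (intro mult_right_mono) auto
      moreover have "real k = a + real (r p)" by (simp add: a_def)
      ultimately show ?thesis by (simp add: algebra_simps)
    qed
    then have "2 ^ p * (2 * (real k + 1)) \<le> 2 ^ p * (a * (real (r p) + 3))"
      by (intro mult_left_mono) auto
    then have "2 * (2 ^ p * (real k + 1)) \<le> 2 ^ p * (a * (real (r p) + 3))"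
      by (simp only: mult.left_commute)
    ultimately have "2 ^ p * (real k + 1) \<le> a * B p" by linarith
    then have "2 ^ (p + 1) / (a * B p) \<le> 2 / (real k + 1)"
      using a Bp by (simp add: field_simps)
    then have "(2 ^ (p + 1) / (a * B p))\<^sup>2 \<le> (2 / (real k + 1))\<^sup>2"
      using a Bp by (intro power_mono) auto
    then have "(2 ^ (p + 1) / (a * B p))\<^sup>2 * (L / 2) * (x0 - xstar)\<^sup>2
        \<le> (2 / (real k + 1))\<^sup>2 * (L / 2) * (x0 - xstar)\<^sup>2"
      using L by (intro mult_right_mono) auto
    also have "\<dots> = 2 * L * (x0 - xstar)\<^sup>2 / (real k + 1)\<^sup>2"
      by (simp add: power_divide)
    finally show ?thesis .
  qed
  show ?thesis
    using val rate by (simp add: a_def B_def mult.assoc)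
qed

end
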